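(* There exists an absolute constant $C>0$ such that for every integer $m\ge 1$, $$ J_m \le C\, 2^{-m+(5/2)\log_2 m}. $$
   Context: $T=[-\pi,\pi)$ is the circle $\mathbb{R}/2\pi\mathbb{Z}$, and $C(T)$ is the space of continuous (complex-valued, $2\pi$-periodic) functions on $T$ with norm $\|f\|:=\max_{x\in T}|f(x)|$. $T_n$ denotes the space of trigonometric polynomials $\sum_{j=-n}^{n}c_je^{ijt}$ of degree at most $n$, and $E_n(f):=\inf_{\tau\in T_n}\|f-\tau\|$. For an integer $m\ge1$ and a real step $h$, the (central) $m$-th difference is $$\Delta_h^m f(x):=\sum_{i=0}^m(-1)^{m-i}\binom{m}{i} f\bigl(x-(m/2)h+ih\bigr),$$ and the $m$-th modulus of smoothness is $\omega_m(f,\delta):=\sup_{x\in T,\ |h|<\delta}|\Delta_h^m f(x)|$ for $\delta>0$. For each integer $m\ge 1$, the Jackson--Stechkin constant $J_m$ is the smallest constant (depending only on $m$) such that $$E_n(f)\le J_m\,\omega_m\Bigl(f,\frac{2\pi}{n}\Bigr)\qquad\text{for all } f\in C(T)\text{ and all integers } n\ge m;$$ such a finite constant exists by the classical Jackson--Akhiezer--Stechkin theorem. *)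

theory Defs
  imports "HOL-Analysis.Analysis"
begin

text \<open>Functions on the circle are represented by \<open>2\<pi>\<close>-periodic functions on the real line.\<close>

definition circle_continuous :: "(real \<Rightarrow> complex) set" where
  "circle_continuous = {f. continuous_on UNIV f \<and> (\<forall>x. f (x + 2 * pi) = f x)}"

definition circle_norm :: "(real \<Rightarrow> complex) \<Rightarrow> real" where
  "circle_norm f = (SUP x\<in>{-pi..<pi}. norm (f x))"

definition trig_polys :: "nat \<Rightarrow> (real \<Rightarrow> complex) set" where
  "trig_polys n =
     {\<lambda>t. \<Sum>j=-int n..int n. c j * exp (\<i> * of_int j * of_real t) | c :: int \<Rightarrow> complex. True}"

definition best_approx :: "nat \<Rightarrow> (real \<Rightarrow> complex) \<Rightarrow> real" where
  "best_approx n f = (INF \<tau>\<in>trig_polys n. circle_norm (\<lambda>x. f x - \<tau> x))"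

definition central_diff :: "nat \<Rightarrow> real \<Rightarrow> (real \<Rightarrow> complex) \<Rightarrow> real \<Rightarrow> complex" where
  "central_diff m h f x =
     (\<Sum>i=0..m. (-1) ^ (m - i) * of_nat (m choose i) * f (x - (real m / 2) * h + real i * h))"

definition modulus_smoothness :: "nat \<Rightarrow> (real \<Rightarrow> complex) \<Rightarrow> real \<Rightarrow> real" where
  "modulus_smoothness m f \<delta> =
     (SUP (x, h)\<in>{-pi..<pi} \<times> {h. \<bar>h\<bar> < \<delta>}. norm (central_diff m h f x))"

text \<open>
  The infimum is taken in the extended reals so that it would be \<open>\<infinity>\<close>, and not an unspecified
  real number, if no admissible constant existed. As the inequality is not strict, the set of
  admissible constants is closed, so a finite infimum is the smallest admissible constant.
\<close>

definition jackson_stechkin_const :: "nat \<Rightarrow> ereal" where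
  "jackson_stechkin_const m =
     (INF J\<in>{J :: real. \<forall>f\<in>circle_continuous. \<forall>n\<ge>m.
         best_approx n f \<le> J * modulus_smoothness m f (2 * pi / real n)}. ereal J)"

end

(*
  By density and by Delta^(m+1) f(x) = Delta^m f(x + h/2) - Delta^m f(x - h/2), it suffices to treat
  trigonometric polynomials f and even m = 2k.  Averaging Delta_t^(2k) f over 0 <= t <= h against the
  tent weight and dividing by (2k choose k) gives W f = f - U f with
  |W f| <= omega / (2k choose k), where U is a combination of second differences of step i*h
  (1 <= i <= k) composed with the Fourier multiplier 1 / l^2.  Let g = f - V f for a de la Vallee Poussin
  mean V into T_n that fixes all frequencies below p, where p is close to n.  On g the multiplier
  1 / l^2 may be replaced by any sequence that agrees with it for |l| >= p; the convex one that
  continues along the tangent at p has norm 3 / p^2 by positivity of the Fejer kernels.  For h just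
  below 2 pi / n this makes U a contraction on g, so |g| is at most a constant times |W g|, and
  1 / (2k choose k) <= 2k / 4^k leaves room to spare in the power of m.
*)

theory Submission
  imports Defs
begin

section \<open>Trigonometric sums given by coefficients, on which Fourier multipliers act
  pointwise\<close>

definition trig_sum :: "nat \<Rightarrow> (int \<Rightarrow> complex) \<Rightarrow> real \<Rightarrow> complex" where
  "trig_sum N c x = (\<Sum>l=-int N..int N. c l * cis (of_int l * x))"

text \<open>The squared modulus is \<open>j\<close> times a Fejer kernel: the frequency l occurs in
  it with coefficient j - |l| for |l| < j. Writing the kernel as a square makes its positivity
  evident.\<close>

definition dirichlet_sum :: "nat \<Rightarrow> real \<Rightarrow> complex" where
  "dirichlet_sum j x = (\<Sum>r<j. cis (real r * x))"

lemma trig_polys_eq_range: "trig_polys n = range (trig_sum n)"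
  by (auto simp: trig_polys_def trig_sum_def cis_conv_exp mult.assoc intro!: ext)

lemma trig_sum_add: "trig_sum N (\<lambda>l. c l + d l) x = trig_sum N c x + trig_sum N d x"
  by (simp add: trig_sum_def sum.distrib algebra_simps)

lemma trig_sum_diff: "trig_sum N (\<lambda>l. c l - d l) x = trig_sum N c x - trig_sum N d x"
  by (simp add: trig_sum_def sum_subtractf algebra_simps)

lemma trig_sum_scale: "trig_sum N (\<lambda>l. a * c l) x = a * trig_sum N c x"
  by (simp add: trig_sum_def sum_distrib_left algebra_simps)

lemma trig_sum_sum: "trig_sum N (\<lambda>l. \<Sum>i\<in>I. c i l) x = (\<Sum>i\<in>I. trig_sum N (c i) x)"
  unfolding trig_sum_def sum_distrib_right by (rule sum.swap)

lemma trig_sum_cong: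
  "(\<And>l. nat \<bar>l\<bar> \<le> N \<Longrightarrow> c l = d l) \<Longrightarrow> trig_sum N c x = trig_sum N d x"
  unfolding trig_sum_def by (rule sum.cong) auto

lemma norm_trig_sum_le: "norm (trig_sum N c x) \<le> (\<Sum>l=-int N..int N. norm (c l))"
  unfolding trig_sum_def by (rule sum_norm_le) (simp add: norm_mult)

lemma trig_polys_add:
  assumes "f \<in> trig_polys n" "g \<in> trig_polys n"
  shows "(\<lambda>x. f x + g x) \<in> trig_polys n"
proof -
  obtain c d where "f = trig_sum n c" "g = trig_sum n d"
    using assms by (auto simp: trig_polys_eq_range)
  then have "(\<lambda>x. f x + g x) = trig_sum n (\<lambda>l. c l + d l)"
    by (simp add: trig_sum_add fun_eq_iff)
  then show ?thesis by (simp add: trig_polys_eq_range)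
qed

lemma trig_polys_scale:
  assumes "f \<in> trig_polys n"
  shows "(\<lambda>x. a * f x) \<in> trig_polys n"
proof -
  obtain c where "f = trig_sum n c"
    using assms by (auto simp: trig_polys_eq_range)
  then have "(\<lambda>x. a * f x) = trig_sum n (\<lambda>l. a * c l)"
    by (simp add: trig_sum_scale fun_eq_iff)
  then show ?thesis by (simp add: trig_polys_eq_range)
qed

lemma trig_polys_zero: "(\<lambda>x. 0) \<in> trig_polys n"
  unfolding trig_polys_eq_range by (rule image_eqI[of _ _ "\<lambda>l. 0"]) (auto simp: trig_sum_def)

lemma trig_polys_sum:
  assumes "\<And>i. i \<in> I \<Longrightarrow> f i \<in> trig_polys n"
  shows "(\<lambda>x. \<Sum>i\<in>I. f i x) \<in> trig_polys n"
  using assms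
  by (induction I rule: infinite_finite_induct) (auto intro: trig_polys_add trig_polys_zero)

lemma trig_polys_cis:
  assumes "\<bar>k\<bar> \<le> int n"
  shows "(\<lambda>x. cis (of_int k * x)) \<in> trig_polys n"
proof -
  have "trig_sum n (\<lambda>l. if l = k then 1 else 0) x = cis (of_int k * x)" for x
  proof -
    have "trig_sum n (\<lambda>l. if l = k then 1 else 0) x
        = (\<Sum>l=-int n..int n. if l = k then cis (of_int l * x) else 0)"
      unfolding trig_sum_def by (rule sum.cong) auto
    then show ?thesis using assms by (auto simp: sum.delta)
  qed
  then have "(\<lambda>x. cis (of_int k * x)) = trig_sum n (\<lambda>l. if l = k then 1 else 0)" by (simp add: fun_eq_iff)
  then show ?thesis by (simp add: trig_polys_eq_range)
qed

section \<open>Fejer kernels and convex multipliers\<close>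

text \<open>For nonzero l the sum is geometric in an \<open>M\<close>-th root of unity, which
  differs from 1 because \<open>M\<close> does not divide l when 0 < |l| < \<open>M\<close>.\<close>

lemma sum_cis_grid:
  assumes "\<bar>l\<bar> < int M"
  shows "(\<Sum>s<M. cis (of_int l * (x - 2 * pi * real s / real M))) = (if l = 0 then of_nat M else 0)"
proof (cases "l = 0")
  case False
  define z where "z = cis (- (2 * pi * of_int l / real M))"
  have M: "M > 0" using assms by auto
  have "z \<noteq> 1"
  proof
    assume "z = 1"
    then have "cos (2 * pi * of_int l / real M) = 1"
      by (auto simp: z_def complex_eq_iff)
    then obtain q :: int where "2 * pi * of_int l / real M = of_int q * 2 * pi"
      by (auto simp: cos_one_2pi_int)
    then have "real_of_int l = of_int q * real M" using M by (simp add: field_simps)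
    then have "l = q * int M" by (metis of_int_eq_iff of_int_mult of_int_of_nat_eq)
    then have "q \<noteq> 0" "\<bar>q\<bar> * int M < int M" using assms False by (auto simp: abs_mult)
    moreover have "1 * int M \<le> \<bar>q\<bar> * int M"
      using \<open>q \<noteq> 0\<close> by (intro mult_right_mono) auto
    ultimately show False by linarith
  qed
  have zM: "z ^ M = 1"
  proof -
    have "z ^ M = cis (2 * pi * of_int (-l))"
      using M unfolding z_def Complex.DeMoivre by simp
    also have "\<dots> = 1" by (rule cis_multiple_2pi) auto
    finally show ?thesis .
  qed
  have "(\<Sum>s<M. cis (of_int l * (x - 2 * pi * real s / real M))) = (\<Sum>s<M. cis (of_int l * x) * z ^ s)"
    by (rule sum.cong) (auto simp: z_def Complex.DeMoivre cis_mult algebra_simps)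
  also have "\<dots> = cis (of_int l * x) * (\<Sum>s<M. z ^ s)"
    by (simp add: sum_distrib_left)
  also have "(\<Sum>s<M. z ^ s) = 0"
    using geometric_sum[OF \<open>z \<noteq> 1\<close>, of M] zM by simp
  finally show ?thesis using False by simp
qed simp

lemma dirichlet_sum_norm_square:
  "complex_of_real ((norm (dirichlet_sum j x))\<^sup>2)
     = (\<Sum>r<j. \<Sum>q<j. cis (of_int (int r - int q) * x))"
proof -
  have "complex_of_real ((norm (dirichlet_sum j x))\<^sup>2) = dirichlet_sum j x * cnj (dirichlet_sum j x)"
    by (rule complex_norm_square)
  also have "\<dots> = (\<Sum>r<j. \<Sum>q<j. cis (of_int (int r - int q) * x))"
    unfolding dirichlet_sum_def cnj_sum sum_product
    by (intro sum.cong refl) (simp add: cis_cnj cis_mult algebra_simps)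
  finally show ?thesis .
qed

text \<open>For each r at most one q solves the equation, and the r for which it lies below
  \<open>j\<close> form an interval. The truncation by \<open>nat\<close> gives 0 when |l| >=
  \<open>j\<close>.\<close>

lemma sum_pairs_difference:
  "(\<Sum>r<j. \<Sum>q<j. if l + int r - int q = 0 then a else 0) = real (nat (int j - \<bar>l\<bar>)) * (a::real)"
proof -
  have "(\<Sum>q<j. if l + int r - int q = 0 then a else 0) = (if r \<in> {nat (-l)..<nat (int j - l)} then a else 0)"
    if "r < j" for r
  proof -
    have "(\<Sum>q<j. if l + int r - int q = 0 then a else 0)
        = (\<Sum>q<j. if q = nat (l + int r) then (if l + int r \<ge> 0 then a else 0) else 0)"
      by (rule sum.cong) auto
    also have "\<dots> = (if nat (l + int r) < j then (if l + int r \<ge> 0 then a else 0) else 0)"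
      by (simp add: sum.delta)
    also have "\<dots> = (if r \<in> {nat (-l)..<nat (int j - l)} then a else 0)"
      by auto
    finally show ?thesis .
  qed
  then have "(\<Sum>r<j. \<Sum>q<j. if l + int r - int q = 0 then a else 0)
      = (\<Sum>r<j. if r \<in> {nat (-l)..<nat (int j - l)} then a else 0)"
    by (intro sum.cong) auto
  also have "\<dots> = (\<Sum>r\<in>{..<j} \<inter> {nat (-l)..<nat (int j - l)}. a)"
    by (rule sum.inter_restrict[symmetric]) simp
  also have "{..<j} \<inter> {nat (-l)..<nat (int j - l)} = {nat (-l)..<min j (nat (int j - l))}"
    by auto
  also have "card \<dots> = nat (int j - \<bar>l\<bar>)" by auto
  then have "(\<Sum>r\<in>{nat (-l)..<min j (nat (int j - l))}. a) = real (nat (int j - \<bar>l\<bar>)) * a" by simp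
  finally show ?thesis .
qed

text \<open>All frequencies l + r - q with r, q < \<open>j\<close> have modulus below
  \<open>M\<close>, so there is no aliasing: the grid sum keeps exactly the pairs with l + r - q =
  0.\<close>

lemma sum_dirichlet_sum_grid:
  assumes "\<bar>l\<bar> + int j \<le> int M"
  shows "(\<Sum>s<M. cis (of_int l * (x - 2 * pi * real s / real M)) *
           of_real ((norm (dirichlet_sum j (x - 2 * pi * real s / real M)))\<^sup>2))
         = of_nat (nat (int j - \<bar>l\<bar>)) * of_nat M"
proof -
  define y where "y s = x - 2 * pi * real s / real M" for s
  have "(\<Sum>s<M. cis (of_int l * y s) * of_real ((norm (dirichlet_sum j (y s)))\<^sup>2))
      = (\<Sum>s<M. \<Sum>r<j. \<Sum>q<j. cis (of_int (l + int r - int q) * y s))"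
    unfolding dirichlet_sum_norm_square sum_distrib_left
    by (intro sum.cong refl) (simp add: cis_mult algebra_simps)
  also have "\<dots> = (\<Sum>r<j. \<Sum>q<j. \<Sum>s<M. cis (of_int (l + int r - int q) * y s))"
    by (subst sum.swap) (intro sum.cong refl sum.swap)
  also have "\<dots> = (\<Sum>r<j. \<Sum>q<j. if l + int r - int q = 0 then of_nat M else 0)"
    unfolding y_def using assms by (intro sum.cong refl sum_cis_grid) auto
  also have "\<dots> = (\<Sum>r<j. \<Sum>q<j. complex_of_real (if l + int r - int q = 0 then real M else 0))"
    by (intro sum.cong refl) auto
  also have "\<dots> = complex_of_real (real (nat (int j - \<bar>l\<bar>)) * real M)"
    unfolding sum_pairs_difference[symmetric] by simp
  finally show ?thesis unfolding y_def by simp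
qed

lemma sum_norm_dirichlet_sum_grid:
  assumes "j \<le> M"
  shows "(\<Sum>s<M. (norm (dirichlet_sum j (x - 2 * pi * real s / real M)))\<^sup>2) = real j * real M"
proof -
  have "complex_of_real (\<Sum>s<M. (norm (dirichlet_sum j (x - 2 * pi * real s / real M)))\<^sup>2)
      = complex_of_real (real j * real M)"
    using sum_dirichlet_sum_grid[of 0 j M x] assms by simp
  then show ?thesis by (simp only: of_real_eq_iff)
qed

text \<open>Exact quadrature on an equidistant grid replaces the convolution integral with the Fejer kernel.\<close>

lemma fejer_multiplier_bound:
  assumes B: "\<And>x. norm (trig_sum N c x) \<le> B"
  shows "norm (trig_sum N (\<lambda>l. of_nat (nat (int j - \<bar>l\<bar>)) * c l) x) \<le> real j * B"
proof -
  \<comment> \<open>Large enough for the quadrature to be exact at every frequency |l| <=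
    \<open>N\<close>.\<close>
  define M where "M = N + j + 1"
  define y where "y s = (0::real) - 2 * pi * real s / real M" for s
  define K where "K s = (norm (dirichlet_sum j (y s)))\<^sup>2" for s
  have "(\<Sum>s<M. trig_sum N c (x - y s) * of_real (K s))
      = (\<Sum>s<M. \<Sum>l=-int N..int N. c l * cis (of_int l * x) * (cis (of_int (-l) * y s) * of_real (K s)))"
    unfolding trig_sum_def sum_distrib_right
    by (intro sum.cong refl) (simp add: cis_mult algebra_simps)
  also have "\<dots> = (\<Sum>l=-int N..int N. c l * cis (of_int l * x) * (\<Sum>s<M. cis (of_int (-l) * y s) * of_real (K s)))"
    unfolding sum_distrib_left by (rule sum.swap)
  also have "\<dots> = (\<Sum>l=-int N..int N. c l * cis (of_int l * x) * (of_nat (nat (int j - \<bar>-l\<bar>)) * of_nat M))"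
    unfolding y_def K_def M_def by (intro sum.cong refl, subst sum_dirichlet_sum_grid) auto
  also have "\<dots> = of_nat M * trig_sum N (\<lambda>l. of_nat (nat (int j - \<bar>l\<bar>)) * c l) x"
    unfolding trig_sum_def sum_distrib_left by (simp add: algebra_simps)
  finally have eq: "of_nat M * trig_sum N (\<lambda>l. of_nat (nat (int j - \<bar>l\<bar>)) * c l) x
      = (\<Sum>s<M. trig_sum N c (x - y s) * of_real (K s))" ..
  have "real M * norm (trig_sum N (\<lambda>l. of_nat (nat (int j - \<bar>l\<bar>)) * c l) x)
      = norm (\<Sum>s<M. trig_sum N c (x - y s) * of_real (K s))"
    unfolding eq[symmetric] by (simp add: norm_mult)
  also have "\<dots> \<le> (\<Sum>s<M. B * K s)"
    by (rule sum_norm_le) (use B in \<open>auto simp: norm_mult norm_power K_def intro!: mult_right_mono\<close>)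
  also have "\<dots> = B * (real j * real M)"
    unfolding sum_distrib_left[symmetric] K_def y_def
    by (subst sum_norm_dirichlet_sum_grid) (auto simp: M_def)
  finally have "real M * norm (trig_sum N (\<lambda>l. of_nat (nat (int j - \<bar>l\<bar>)) * c l) x) \<le> real M * (real j * B)"
    by (simp add: algebra_simps)
  then show ?thesis by (subst (asm) mult_le_cancel_left_pos) (auto simp: M_def)
qed

text \<open>Summation by parts twice, a discrete Taylor formula at the right end \<open>L\<close>.
  The truncated difference \<open>Suc j - l\<close> drops the terms with j < l and, as a function of
  l, is a Fejer multiplier.\<close>

lemma second_difference_representation:
  fixes a :: "nat \<Rightarrow> real"
  assumes "l \<le> L"
  shows "a l = a L + (real L - real l) * (a L - a (Suc L))
               + (\<Sum>j<L. real (Suc j - l) * (a j - 2 * a (Suc j) + a (Suc (Suc j))))"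
  using assms
proof (induction rule: dec_induct)
  case base
  then show ?case by simp
next
  case (step L)
  then show ?case by (simp add: of_nat_diff algebra_simps)
qed

text \<open>A convex decreasing sequence is a positive combination of Fejer multipliers and of the identity.\<close>

lemma convex_multiplier_bound:
  fixes a :: "nat \<Rightarrow> real"
  assumes B: "\<And>x. norm (trig_sum N c x) \<le> B"
    and nonneg: "\<And>i. a i \<ge> 0"
    and decr: "\<And>i. a (Suc i) \<le> a i"
    and conv: "\<And>i. 2 * a (Suc i) \<le> a i + a (Suc (Suc i))"
  shows "norm (trig_sum N (\<lambda>l. of_real (a (nat \<bar>l\<bar>)) * c l) x) \<le> a 0 * B"
proof -
  define d where "d j = a j - 2 * a (Suc j) + a (Suc (Suc j))" for j
  define F where "F j = trig_sum N (\<lambda>l. of_nat (nat (int j - \<bar>l\<bar>)) * c l) x" for j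
  have F: "norm (F j) \<le> real j * B" for j
    unfolding F_def by (rule fejer_multiplier_bound) (rule B)
  have "trig_sum N (\<lambda>l. of_real (a (nat \<bar>l\<bar>)) * c l) x
     = trig_sum N (\<lambda>l. of_real (a N) * c l + of_real (a N - a (Suc N)) * (of_nat (nat (int N - \<bar>l\<bar>)) * c l)
         + (\<Sum>j<N. of_real (d j) * (of_nat (nat (int (Suc j) - \<bar>l\<bar>)) * c l))) x"
  proof (rule trig_sum_cong)
    fix l :: int assume l: "nat \<bar>l\<bar> \<le> N"
    have *: "nat (int j - \<bar>l\<bar>) = j - nat \<bar>l\<bar>" for j by auto
    have "a (nat \<bar>l\<bar>) = a N + (a N - a (Suc N)) * real (N - nat \<bar>l\<bar>)
        + (\<Sum>j<N. d j * real (Suc j - nat \<bar>l\<bar>))"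
      using second_difference_representation[OF l, of a] l
      by (simp add: d_def of_nat_diff mult.commute del: of_nat_Suc)
    then have "complex_of_real (a (nat \<bar>l\<bar>)) = of_real (a N) + of_real (a N - a (Suc N)) * of_nat (N - nat \<bar>l\<bar>)
        + (\<Sum>j<N. of_real (d j) * of_nat (Suc j - nat \<bar>l\<bar>))"
      by (simp only: of_real_add of_real_mult of_real_sum of_real_of_nat_eq)
    then show "of_real (a (nat \<bar>l\<bar>)) * c l = of_real (a N) * c l + of_real (a N - a (Suc N)) * (of_nat (nat (int N - \<bar>l\<bar>)) * c l)
         + (\<Sum>j<N. of_real (d j) * (of_nat (nat (int (Suc j) - \<bar>l\<bar>)) * c l))"
      unfolding * by (simp only: distrib_right sum_distrib_right mult.assoc)
  qed
  also have "\<dots> = of_real (a N) * trig_sum N c x + of_real (a N - a (Suc N)) * F N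
      + (\<Sum>j<N. of_real (d j) * F (Suc j))"
    unfolding trig_sum_add trig_sum_scale trig_sum_sum F_def ..
  also have "norm \<dots> \<le> a N * B + (a N - a (Suc N)) * (real N * B) + (\<Sum>j<N. d j * (real (Suc j) * B))"
  proof (intro norm_triangle_mono sum_norm_le)
    show "norm (of_real (a N) * trig_sum N c x) \<le> a N * B"
      using nonneg[of N] B by (auto simp: norm_mult intro!: mult_left_mono)
    show "norm (of_real (a N - a (Suc N)) * F N) \<le> (a N - a (Suc N)) * (real N * B)"
      using decr[of N] F by (simp add: norm_mult mult_left_mono del: of_real_diff)
    show "norm (of_real (d j) * F (Suc j)) \<le> d j * (real (Suc j) * B)" for j
      using conv[of j] F[of "Suc j"] by (simp add: norm_mult d_def mult_left_mono del: of_real_diff of_real_add of_nat_Suc)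
  qed
  \<comment> \<open>The same representation at l = 0: the norms of the pieces add up without
    loss.\<close>
  also have "\<dots> = a 0 * B"
    by (subst second_difference_representation[of 0 N a])
      (simp_all add: d_def algebra_simps sum_distrib_left)
  finally show ?thesis .
qed

section \<open>Density of trigonometric polynomials\<close>

lemma periodic_of_int_shift:
  assumes "\<And>x. f (x + 2 * pi) = f x"
  shows "f (x + 2 * pi * of_int k) = f x"
proof -
  have nat: "f (x + 2 * pi * real n) = f x" for n x
  proof (induction n)
    case (Suc n)
    have "f (x + 2 * pi * real (Suc n)) = f ((x + 2 * pi * real n) + 2 * pi)"
      by (simp add: algebra_simps)
    then show ?case using assms Suc by simp
  qed simp
  show ?thesis
  proof (cases "k \<ge> 0")
    case True
    then show ?thesis using nat[of x "nat k"] by simp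
  next
    case False
    then show ?thesis using nat[of "x + 2 * pi * of_int k" "nat (-k)"] by simp
  qed
qed

lemma ex_circle_representative: "\<exists>k::int. x + 2 * pi * of_int k \<in> {-pi..<pi}"
proof -
  define k where "k = \<lfloor>(x + pi) / (2 * pi)\<rfloor>"
  have "of_int k \<le> (x + pi) / (2 * pi)" "(x + pi) / (2 * pi) < of_int k + 1"
    unfolding k_def by linarith+
  then have "x + 2 * pi * of_int (-k) \<in> {-pi..<pi}"
    by (auto simp: field_simps)
  then show ?thesis by blast
qed

lemma circle_continuous_periodic:
  "f \<in> circle_continuous \<Longrightarrow> f (x + 2 * pi * of_int k) = f x"
  by (rule periodic_of_int_shift) (simp add: circle_continuous_def)

lemma circle_continuous_bounded:
  assumes "f \<in> circle_continuous"
  obtains F where "F \<ge> 0" "\<And>x. norm (f x) \<le> F"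
proof -
  have "continuous_on {-pi..pi} f"
    using assms continuous_on_subset by (auto simp: circle_continuous_def)
  then have "bounded (f ` {-pi..pi})"
    by (intro compact_imp_bounded compact_continuous_image) auto
  then obtain F where F: "\<forall>x\<in>{-pi..pi}. norm (f x) \<le> F"
    by (auto simp: bounded_iff)
  have "norm (f x) \<le> F" for x
  proof -
    obtain k :: int where "x + 2 * pi * of_int k \<in> {-pi..<pi}"
      using ex_circle_representative by blast
    then show ?thesis using F[rule_format, of "x + 2 * pi * of_int k"] circle_continuous_periodic[OF assms, of x k] by simp
  qed
  moreover from this have "F \<ge> 0" using norm_ge_zero order_trans by blast
  ultimately show thesis using that by blast
qed

text \<open>
  Korovkin's trick: in this form the error of a positive kernel is controlled by its action on \<open>cos\<close> alone.
\<close>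

lemma circle_continuous_increment:
  assumes f: "f \<in> circle_continuous" and "\<epsilon> > 0"
  obtains A where "A \<ge> 0" "\<And>x y. norm (f x - f y) \<le> \<epsilon> + A * (1 - cos (x - y))"
proof -
  obtain F where F: "F \<ge> 0" "\<And>x. norm (f x) \<le> F"
    using circle_continuous_bounded[OF f] by blast
  \<comment> \<open>This interval contains every point of the base period together with its shifts
    by less than pi.\<close>
  have "uniformly_continuous_on {-2*pi..2*pi} f"
    using f continuous_on_subset by (intro compact_uniformly_continuous) (auto simp: circle_continuous_def)
  then obtain d0 where d0: "d0 > 0"
    "\<And>x y. x \<in> {-2*pi..2*pi} \<Longrightarrow> y \<in> {-2*pi..2*pi} \<Longrightarrow> dist y x < d0 \<Longrightarrow> dist (f y) (f x) < \<epsilon>"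
    using \<open>\<epsilon> > 0\<close> unfolding uniformly_continuous_on_def by meson
  define d where "d = min d0 pi"
  have d: "0 < d" "d \<le> pi" using d0(1) by (auto simp: d_def)
  have cosd: "cos d < 1" using cos_monotone_0_pi[of 0 d] d by simp
  \<comment> \<open>Makes the cosine term at least 2 \<open>F\<close>, the trivial bound, for points
    at circle distance at least \<open>d\<close>.\<close>
  define A where "A = 2 * F / (1 - cos d)"
  have A: "A \<ge> 0" using F cosd by (simp add: A_def)
  show thesis
  proof (rule that[OF A])
    fix x y
    obtain j :: int where j: "y + 2 * pi * of_int j \<in> {-pi..<pi}"
      using ex_circle_representative by blast
    obtain k :: int where k: "(x - y) + 2 * pi * of_int k \<in> {-pi..<pi}"
      using ex_circle_representative by blast
    define z where "z = (x - y) + 2 * pi * of_int k"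
    define y' where "y' = y + 2 * pi * of_int j"
    have "f (x + 2 * pi * of_int (j + k)) = f x" by (rule circle_continuous_periodic[OF f])
    moreover have "x + 2 * pi * of_int (j + k) = y' + z" by (simp add: y'_def z_def algebra_simps)
    ultimately have fx: "f x = f (y' + z)" by simp
    have fy: "f y = f y'" unfolding y'_def using circle_continuous_periodic[OF f] by simp
    have cosz: "cos (x - y) = cos z"
      using cos_int_2pin[of k] sin_int_2pin[of k] unfolding z_def by (simp add: cos_add)
    show "norm (f x - f y) \<le> \<epsilon> + A * (1 - cos (x - y))"
    proof (cases "\<bar>z\<bar> < d")
      case True
      have "y' \<in> {-2*pi..2*pi}" "y' + z \<in> {-2*pi..2*pi}" "dist (y' + z) y' < d0"
        using j k True unfolding y'_def[symmetric] z_def[symmetric] by (auto simp: dist_norm d_def)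
      then have "norm (f x - f y) < \<epsilon>" using d0(2)[of y' "y' + z"] fx fy by (simp add: dist_norm)
      moreover have "A * (1 - cos (x - y)) \<ge> 0" using A by simp
      ultimately show ?thesis by linarith
    next
      case False
      have "cos \<bar>z\<bar> \<le> cos d"
        by (rule cos_monotone_0_pi_le) (use False d k in \<open>auto simp: z_def[symmetric]\<close>)
      then have "cos (x - y) \<le> cos d" using cosz by simp
      then have "A * (1 - cos d) \<le> A * (1 - cos (x - y))" using A by (intro mult_left_mono) auto
      moreover have "A * (1 - cos d) = 2 * F" using cosd by (simp add: A_def)
      moreover have "norm (f x - f y) \<le> 2 * F"
        using norm_triangle_ineq4[of "f x" "f y"] F(2)[of x] F(2)[of y] by linarith
      ultimately show ?thesis using \<open>\<epsilon> > 0\<close> by linarith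
    qed
  qed
qed

lemma dirichlet_sum_norm_square_trig_poly:
  "(\<lambda>x. complex_of_real ((norm (dirichlet_sum j (x - y)))\<^sup>2)) \<in> trig_polys j"
proof -
  have "(\<lambda>x. \<Sum>r<j. \<Sum>q<j. cis (- (of_int (int r - int q) * y)) * cis (of_int (int r - int q) * x)) \<in> trig_polys j"
    by (intro trig_polys_sum trig_polys_scale trig_polys_cis) auto
  also have "(\<lambda>x. \<Sum>r<j. \<Sum>q<j. cis (- (of_int (int r - int q) * y)) * cis (of_int (int r - int q) * x))
      = (\<lambda>x. complex_of_real ((norm (dirichlet_sum j (x - y)))\<^sup>2))"
    unfolding dirichlet_sum_norm_square
    by (intro ext sum.cong refl) (simp add: cis_mult algebra_simps)
  finally show ?thesis .
qed

text \<open>The approximant is a discrete Fejer mean of samples of \<open>f\<close>. Its kernel is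
  positive with mass 1 and first cosine moment 1 - 1/j, so the increment estimate gives the error
  \<epsilon>/2 + A/j.\<close>

lemma trig_poly_dense:
  assumes f: "f \<in> circle_continuous" and "\<epsilon> > 0"
  obtains N c where "\<And>x. norm (f x - trig_sum N c x) \<le> \<epsilon>"
proof -
  obtain A where A: "A \<ge> 0" "\<And>x y. norm (f x - f y) \<le> \<epsilon> / 2 + A * (1 - cos (x - y))"
    using circle_continuous_increment[OF f, of "\<epsilon> / 2"] \<open>\<epsilon> > 0\<close> by auto
  define j where "j = Suc (nat \<lceil>2 * A / \<epsilon>\<rceil>)"
  have j: "A / real j \<le> \<epsilon> / 2"
  proof -
    have "2 * A / \<epsilon> \<le> real j" unfolding j_def by linarith
    then show ?thesis using \<open>\<epsilon> > 0\<close> by (simp add: field_simps j_def)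
  qed
  \<comment> \<open>The quadrature has to be exact only at the frequencies 0 (\<open>mass\<close>)
    and 1 (\<open>first\<close>).\<close>
  define M where "M = j + 1"
  define y where "y s = 2 * pi * real s / real M" for s
  define K where "K x s = (norm (dirichlet_sum j (x - y s)))\<^sup>2" for x s
  define p where "p x = (\<Sum>s<M. (f (y s) / (of_nat j * of_nat M)) * of_real (K x s))" for x
  have "p \<in> trig_polys j"
    unfolding p_def K_def by (intro trig_polys_sum trig_polys_scale dirichlet_sum_norm_square_trig_poly)
  then obtain c where c: "p = trig_sum j c" by (auto simp: trig_polys_eq_range)
  have mass: "(\<Sum>s<M. K x s) = real j * real M" for x
    unfolding K_def y_def by (rule sum_norm_dirichlet_sum_grid) (simp add: M_def)
  have first: "(\<Sum>s<M. cos (x - y s) * K x s) = (real j - 1) * real M" for x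
  proof -
    have "complex_of_real (\<Sum>s<M. cos (x - y s) * K x s) = of_real (Re (\<Sum>s<M. cis (of_int 1 * (x - y s)) * of_real (K x s)))"
      by simp
    also have "\<dots> = of_real ((real j - 1) * real M)"
      unfolding K_def y_def
      by (subst sum_dirichlet_sum_grid) (auto simp: M_def j_def)
    finally show ?thesis by (simp only: of_real_eq_iff)
  qed
  have jM: "real j * real M > 0" by (simp add: j_def M_def)
  have "norm (f x - p x) \<le> \<epsilon>" for x
  proof -
    have "of_real (real j * real M) * (f x - p x) = (\<Sum>s<M. (f x - f (y s)) * of_real (K x s))"
    proof -
      have "of_real (real j * real M) * p x = (\<Sum>s<M. f (y s) * of_real (K x s))"
        unfolding p_def sum_distrib_left using jM by (intro sum.cong) auto
      moreover have "of_real (real j * real M) * f x = (\<Sum>s<M. f x * of_real (K x s))"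
        unfolding mass[of x, symmetric] of_real_sum sum_distrib_right by (simp add: mult.commute)
      ultimately show ?thesis by (simp add: right_diff_distrib left_diff_distrib sum_subtractf)
    qed
    then have "real j * real M * norm (f x - p x) = norm (\<Sum>s<M. (f x - f (y s)) * of_real (K x s))"
      using jM by (metis norm_mult norm_of_real abs_of_pos)
    also have "\<dots> \<le> (\<Sum>s<M. (\<epsilon> / 2 + A * (1 - cos (x - y s))) * K x s)"
      by (rule sum_norm_le)
        (use A(2) in \<open>auto simp: norm_mult norm_power K_def intro!: mult_right_mono\<close>)
    also have "\<dots> = (\<epsilon> / 2 + A) * (\<Sum>s<M. K x s) - A * (\<Sum>s<M. cos (x - y s) * K x s)"
      by (simp add: sum_distrib_left sum.distrib sum_subtractf algebra_simps)
    also have "\<dots> = real j * real M * (\<epsilon> / 2 + A / real j)"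
      unfolding mass first by (simp add: field_simps j_def)
    finally have "norm (f x - p x) \<le> \<epsilon> / 2 + A / real j"
      by (rule mult_left_le_imp_le) (rule jM)
    then show ?thesis using j by linarith
  qed
  then show thesis using that c by metis
qed

section \<open>Multiplier bounds\<close>

text \<open>A trapezoid, written as a difference of two Fejer multipliers: the offsets n + 1 and p -
  1 make it 1 for |l| < p and 0 for |l| > n.\<close>

definition vallee_poussin :: "nat \<Rightarrow> nat \<Rightarrow> int \<Rightarrow> real" where
  "vallee_poussin n p l =
     (real (nat (int (n + 1) - \<bar>l\<bar>)) - real (nat (int p - 1 - \<bar>l\<bar>))) / (real n + 2 - real p)"

lemma vallee_poussin_low:
  "p \<le> n \<Longrightarrow> \<bar>l\<bar> < int p \<Longrightarrow> vallee_poussin n p l = 1"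
  by (auto simp: vallee_poussin_def field_simps)

lemma vallee_poussin_high:
  "p \<le> n \<Longrightarrow> \<bar>l\<bar> > int n \<Longrightarrow> vallee_poussin n p l = 0"
  by (auto simp: vallee_poussin_def)

text \<open>The two Fejer multipliers have norms at most n + 1 and p - 1, whose sum is the
  numerator.\<close>

lemma vallee_poussin_bound:
  assumes B: "\<And>x. norm (trig_sum N c x) \<le> B" and "1 \<le> p" "p \<le> n"
  shows "norm (trig_sum N (\<lambda>l. of_real (vallee_poussin n p l) * c l) x)
           \<le> (real n + real p) / (real n + 2 - real p) * B"
proof -
  define D where "D = real n + 2 - real p"
  have D: "D > 0" using assms by (simp add: D_def)
  define F where "F j = trig_sum N (\<lambda>l. of_nat (nat (int j - \<bar>l\<bar>)) * c l) x" for j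
  have F: "norm (F j) \<le> real j * B" for j
    unfolding F_def by (rule fejer_multiplier_bound) (rule B)
  have p: "int p - 1 = int (p - 1)" using assms by simp
  have "trig_sum N (\<lambda>l. of_real (vallee_poussin n p l) * c l) x
      = of_real (1 / D) * (F (n + 1) - F (p - 1))"
    unfolding F_def trig_sum_diff[symmetric] trig_sum_scale[symmetric]
    by (rule trig_sum_cong)
      (simp add: vallee_poussin_def D_def p diff_divide_distrib algebra_simps)
  also have "norm \<dots> \<le> 1 / D * ((real n + 1) * B + (real p - 1) * B)"
  proof -
    have "norm (F (n + 1) - F (p - 1)) \<le> (real n + 1) * B + (real p - 1) * B"
      using norm_triangle_ineq4[of "F (n + 1)" "F (p - 1)"] F[of "n + 1"] F[of "p - 1"] assms
      by (simp add: of_nat_diff add.commute)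
    then show ?thesis using D by (simp add: norm_mult norm_divide divide_right_mono)
  qed
  finally show ?thesis by (simp add: D_def algebra_simps)
qed

text \<open>Turns each cosine in a symbol into a mean of two translates, which preserves uniform
  bounds.\<close>

lemma trig_sum_cos:
  "trig_sum N (\<lambda>l. of_real (cos (of_int l * t)) * c l) x = (trig_sum N c (x + t) + trig_sum N c (x - t)) / 2"
proof -
  have "complex_of_real (cos (of_int l * t)) * cis (of_int l * x)
      = (cis (of_int l * (x + t)) + cis (of_int l * (x - t))) / 2" for l
    by (simp add: complex_eq_iff cos_add cos_diff sin_add sin_diff algebra_simps)
  then show ?thesis
    unfolding trig_sum_def sum.distrib[symmetric] sum_divide_distrib
    by (intro sum.cong refl) (simp add: algebra_simps add_divide_distrib)
qed

text \<open>Leibniz's argument: removing the first term leaves \<open>y 0\<close> minus an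
  alternating sum that lies between 0 and \<open>y (Suc 0)\<close>.\<close>

lemma alternating_sum_bounds:
  fixes y :: "nat \<Rightarrow> real"
  assumes "\<And>i. y i \<ge> 0" "\<And>i. y (Suc i) \<le> y i"
  shows "0 \<le> (\<Sum>i<k. (-1) ^ i * y i) \<and> (\<Sum>i<k. (-1) ^ i * y i) \<le> y 0"
  using assms
proof (induction k arbitrary: y)
  case (Suc k)
  have "0 \<le> (\<Sum>i<k. (-1) ^ i * y (Suc i))" "(\<Sum>i<k. (-1) ^ i * y (Suc i)) \<le> y (Suc 0)"
    using Suc.IH[of "\<lambda>i. y (Suc i)"] Suc.prems by auto
  moreover have "y (Suc 0) \<le> y 0" by (rule Suc.prems)
  ultimately show ?case
    by (simp add: sum.lessThan_Suc_shift sum_negf del: sum.lessThan_Suc)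
qed simp

text \<open>Only odd \<open>Suc i\<close> contribute, so the full series is pi^2 / 4, just below
  5/2. The bound follows by telescoping, with 1 / (2k + 2) as an upper estimate of the remaining
  tail.\<close>

lemma sum_odd_inverse_squares: "(\<Sum>i<k. (1 + (-1) ^ i) / (real (Suc i))\<^sup>2) \<le> 5 / 2"
proof -
  have *: "(\<Sum>i<2*k+1. (1 + (-1) ^ i) / (real (Suc i))\<^sup>2) \<le> 5 / 2 - 1 / (2 * real k + 2)" for k
  proof (induction k)
    case (Suc k)
    have "(\<Sum>i<2*Suc k+1. (1 + (-1) ^ i) / (real (Suc i))\<^sup>2)
        = (\<Sum>i<2*k+1. (1 + (-1) ^ i) / (real (Suc i))\<^sup>2) + 2 / (2 * real k + 3)\<^sup>2"
      by (simp add: add.commute)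
    also have "2 / (2 * real k + 3)\<^sup>2 \<le> 2 / ((2 * real k + 2) * (2 * real k + 4))"
    proof (rule divide_left_mono)
      show "(2 * real k + 2) * (2 * real k + 4) \<le> (2 * real k + 3)\<^sup>2"
        by (simp add: power2_eq_square algebra_simps)
    qed (auto intro!: mult_pos_pos add_nonneg_pos)
    also have "\<dots> = 1 / (2 * real k + 2) - 1 / (2 * real (Suc k) + 2)"
      by (simp add: divide_simps)
    finally show ?case using Suc.IH by simp
  qed simp
  have "(\<Sum>i<k. (1 + (-1) ^ i) / (real (Suc i))\<^sup>2) \<le> (\<Sum>i<2*k+1. (1 + (-1) ^ i) / (real (Suc i))\<^sup>2)"
    by (rule sum_mono2) (auto simp: minus_one_power_iff)
  also have "\<dots> \<le> 5 / 2 - 1 / (2 * real k + 2)" by (rule *)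
  also have "\<dots> \<le> 5 / 2" by simp
  finally show ?thesis .
qed

section \<open>Symbols of the central differences\<close>

lemma sum_symmetric_interval:
  fixes F :: "nat \<Rightarrow> 'a::comm_monoid_add"
  assumes "j \<le> k"
  shows "(\<Sum>i=k-j..k+j. F i) = F k + (\<Sum>i<j. F (k + Suc i) + F (k - Suc i))"
  using assms
proof (induction j)
  case (Suc j)
  have "{k - Suc j..k + Suc j} = insert (k - Suc j) (insert (k + Suc j) {k - j..k + j})"
    using Suc.prems by auto
  moreover have "k - Suc j \<notin> insert (k + Suc j) {k - j..k + j}" "k + Suc j \<notin> {k - j..k + j}"
    using Suc.prems by auto
  ultimately have "(\<Sum>i=k-Suc j..k+Suc j. F i) = F (k - Suc j) + (F (k + Suc j) + (\<Sum>i=k-j..k+j. F i))"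
    by (simp only: sum.insert finite_insert finite_atLeastAtMost not_False_eq_True)
  then show ?case using Suc by (simp add: add_ac)
qed simp

text \<open>For even order the nodes include x itself and the others pair off symmetrically around
  it; such pairs act on Fourier coefficients as cosines.\<close>

lemma central_diff_even:
  "central_diff (2 * k) t f x = (-1) ^ k * (of_nat ((2 * k) choose k) * f x -
     (\<Sum>i<k. (-1) ^ i * of_nat ((2 * k) choose (k + Suc i)) *
        (f (x + real (Suc i) * t) + f (x - real (Suc i) * t))))"
proof -
  define F where "F i = (-1) ^ (2 * k - i) * of_nat ((2 * k) choose i) * f (x - (real (2 * k) / 2) * t + real i * t)" for i
  have "central_diff (2 * k) t f x = (\<Sum>i=k-k..k+k. F i)"
    by (simp add: central_diff_def F_def flip: mult_2)
  also have "\<dots> = F k + (\<Sum>i<k. F (k + Suc i) + F (k - Suc i))"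
    by (rule sum_symmetric_interval) simp
  also have "F k = (-1) ^ k * of_nat ((2 * k) choose k) * f x"
    by (simp add: F_def)
  also have "(\<Sum>i<k. F (k + Suc i) + F (k - Suc i)) =
      (\<Sum>i<k. - ((-1) ^ k * ((-1) ^ i * of_nat ((2 * k) choose (k + Suc i)) *
        (f (x + real (Suc i) * t) + f (x - real (Suc i) * t)))))"
  proof (rule sum.cong)
    fix i assume "i \<in> {..<k}"
    then have i: "Suc i \<le> k" by simp
    have c: "(2 * k) choose (k - Suc i) = (2 * k) choose (k + Suc i)"
    proof -
      have "2 * k - (k + Suc i) = k - Suc i" by arith
      then show ?thesis using binomial_symmetric[of "k + Suc i" "2 * k"] i by simp
    qed
    have s1: "(-1) ^ (2 * k - (k + Suc i)) = - ((-1) ^ k * (-1) ^ i :: complex)"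
      using i by (auto simp: minus_one_power_iff)
    have s2: "(-1) ^ (2 * k - (k - Suc i)) = - ((-1) ^ k * (-1) ^ i :: complex)"
      using i by (auto simp: minus_one_power_iff)
    have x1: "x - (real (2 * k) / 2) * t + real (k + Suc i) * t = x + real (Suc i) * t"
      by (simp add: algebra_simps)
    have x2: "x - (real (2 * k) / 2) * t + real (k - Suc i) * t = x - real (Suc i) * t"
      using i by (simp add: of_nat_diff algebra_simps)
    show "F (k + Suc i) + F (k - Suc i) = - ((-1) ^ k * ((-1) ^ i * of_nat ((2 * k) choose (k + Suc i)) *
        (f (x + real (Suc i) * t) + f (x - real (Suc i) * t))))"
      unfolding F_def x1 x2 s1 s2 c by (simp add: algebra_simps)
  qed simp
  finally show ?thesis by (simp add: sum_negf sum_distrib_left right_diff_distrib mult.assoc)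
qed

text \<open>Dividing by the central coefficient gives \<open>f\<close> itself the coefficient 1. The
  later estimates use only that the ratios are nonnegative, decreasing in i and at most 1.\<close>

definition binomial_ratio :: "nat \<Rightarrow> nat \<Rightarrow> real" where
  "binomial_ratio k i = real ((2 * k) choose (k + i)) / real ((2 * k) choose k)"

lemma binomial_ratio_nonneg: "0 \<le> binomial_ratio k i"
  by (simp add: binomial_ratio_def)

lemma binomial_ratio_decreasing: "binomial_ratio k (Suc i) \<le> binomial_ratio k i"
proof -
  have "(2 * k) choose (k + Suc i) \<le> (2 * k) choose (k + i)"
  proof (cases "k + Suc i \<le> 2 * k")
    case True
    then show ?thesis by (intro binomial_antimono) auto
  qed (simp add: binomial_eq_0)
  then show ?thesis by (auto simp: binomial_ratio_def intro!: divide_right_mono)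
qed

lemma binomial_ratio_le_1: "binomial_ratio k i \<le> 1"
proof (induction i)
  case (Suc i)
  then show ?case using binomial_ratio_decreasing[of k i] by linarith
qed (simp add: binomial_ratio_def)

text \<open>
  The symbols below are Fourier multipliers, evaluated at \<open>s = l * h\<close> for the frequency \<open>l\<close>:
  \<open>diff_symbol\<close> is that of the \<open>2k\<close>-th difference divided by its central coefficient,
  \<open>mean_symbol\<close> that of its tent-weighted average over the steps in \<open>[0, h]\<close>.
\<close>

definition diff_symbol :: "nat \<Rightarrow> real \<Rightarrow> real" where
  "diff_symbol k s = 1 - 2 * (\<Sum>i<k. (-1) ^ i * binomial_ratio k (Suc i) * cos (real (Suc i) * s))"

lemma central_diff_trig_sum:
  "central_diff (2 * k) t (trig_sum N c) x =
     (-1) ^ k * of_nat ((2 * k) choose k) * trig_sum N (\<lambda>l. of_real (diff_symbol k (of_int l * t)) * c l) x"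
proof -
  define C where "C = complex_of_nat ((2 * k) choose k)"
  have ratio: "C * of_real (binomial_ratio k i) = of_nat ((2 * k) choose (k + i))" for i
    by (simp add: C_def binomial_ratio_def)
  have scale: "C * (2 * s * of_real (binomial_ratio k i) * (z / 2)) = s * of_nat ((2 * k) choose (k + i)) * z" for s i z
    unfolding ratio[symmetric] by (simp add: mult_ac)
  define S where "S = (\<Sum>i<k. (2 * (-1) ^ i * of_real (binomial_ratio k (Suc i))) *
      ((trig_sum N c (x + real (Suc i) * t) + trig_sum N c (x - real (Suc i) * t)) / 2))"
  have "trig_sum N (\<lambda>l. of_real (diff_symbol k (of_int l * t)) * c l) x
      = trig_sum N (\<lambda>l. c l - (\<Sum>i<k. (2 * (-1) ^ i * of_real (binomial_ratio k (Suc i))) *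
            (of_real (cos (of_int l * (real (Suc i) * t))) * c l))) x"
    by (rule trig_sum_cong)
      (simp add: diff_symbol_def left_diff_distrib sum_distrib_left sum_distrib_right algebra_simps)
  also have "\<dots> = trig_sum N c x - S"
    unfolding trig_sum_diff trig_sum_sum trig_sum_scale trig_sum_cos S_def ..
  finally have symbol: "trig_sum N (\<lambda>l. of_real (diff_symbol k (of_int l * t)) * c l) x = trig_sum N c x - S" .
  have "C * S = (\<Sum>i<k. (-1) ^ i * of_nat ((2 * k) choose (k + Suc i)) *
      (trig_sum N c (x + real (Suc i) * t) + trig_sum N c (x - real (Suc i) * t)))"
    unfolding S_def sum_distrib_left scale ..
  then show ?thesis
    unfolding central_diff_even symbol C_def[symmetric] mult.assoc right_diff_distrib by simp
qed

text \<open>This is (sin (s/2) / (s/2))^2, the cosine transform of the tent weight, with its limit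
  as the value at 0. Its denominator is the origin of the multiplier 1 / l^2.\<close>

definition tent_symbol :: "real \<Rightarrow> real" where
  "tent_symbol s = (if s = 0 then 1 else 2 * (1 - cos s) / s\<^sup>2)"

lemma has_integral_tent_cos:
  assumes "h > 0"
  shows "((\<lambda>t. 2 / h\<^sup>2 * (h - t) * cos (w * t)) has_integral tent_symbol (w * h)) {0..h}"
proof (cases "w = 0")
  case True
  have "((\<lambda>t. 2 / h\<^sup>2 * (h - t)) has_integral (2 / h\<^sup>2 * (h * h - h\<^sup>2 / 2) - 2 / h\<^sup>2 * (h * 0 - 0\<^sup>2 / 2))) {0..h}"
    using assms
    by (intro fundamental_theorem_of_calculus)
      (auto intro!: derivative_eq_intros simp flip: has_real_derivative_iff_has_vector_derivative simp: field_simps)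
  then show ?thesis using True assms by (simp add: tent_symbol_def power2_eq_square field_simps)
next
  case False
  \<comment> \<open>The antiderivative obtained by integrating by parts once.\<close>
  define G where "G t = 2 / h\<^sup>2 * ((h - t) * sin (w * t) / w - cos (w * t) / w\<^sup>2)" for t
  have "((\<lambda>t. 2 / h\<^sup>2 * (h - t) * cos (w * t)) has_integral (G h - G 0)) {0..h}"
    unfolding G_def using assms False
    by (intro fundamental_theorem_of_calculus)
      (auto intro!: derivative_eq_intros simp flip: has_real_derivative_iff_has_vector_derivative
         simp: field_simps power2_eq_square)
  moreover have "G h - G 0 = tent_symbol (w * h)"
    using assms False by (simp add: G_def tent_symbol_def field_simps)
  ultimately show ?thesis by simp
qed

definition mean_symbol :: "nat \<Rightarrow> real \<Rightarrow> real" where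
  "mean_symbol k s = 1 - 2 * (\<Sum>i<k. (-1) ^ i * binomial_ratio k (Suc i) * tent_symbol (real (Suc i) * s))"

lemma has_integral_tent:
  fixes h :: real
  assumes "h > 0"
  shows "((\<lambda>t. 2 / h\<^sup>2 * (h - t)) has_integral 1) {0..h}"
  using has_integral_tent_cos[OF assms, of 0] by (simp add: tent_symbol_def)

lemma has_integral_diff_symbol:
  assumes "h > 0"
  shows "((\<lambda>t. 2 / h\<^sup>2 * (h - t) * diff_symbol k (w * t)) has_integral mean_symbol k (w * h)) {0..h}"
proof -
  have "((\<lambda>t. 2 / h\<^sup>2 * (h - t) - 2 * (\<Sum>i<k. ((-1) ^ i * binomial_ratio k (Suc i)) *
            (2 / h\<^sup>2 * (h - t) * cos ((real (Suc i) * w) * t))))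
         has_integral (1 - 2 * (\<Sum>i<k. ((-1) ^ i * binomial_ratio k (Suc i)) * tent_symbol ((real (Suc i) * w) * h)))) {0..h}"
    using assms
    by (intro has_integral_diff has_integral_mult_right has_integral_sum has_integral_tent has_integral_tent_cos) auto
  then show ?thesis
    unfolding mean_symbol_def
    by (rule has_integral_eq_rhs[OF has_integral_eq, rotated])
      (simp_all add: diff_symbol_def right_diff_distrib sum_distrib_left mult_ac)
qed

text \<open>The tent weight is nonnegative with integral 1, so averaging keeps the bound on the
  normalised differences. Dividing by the central binomial coefficient is what produces the
  exponential gain.\<close>

lemma mean_symbol_bound:
  assumes \<Omega>: "\<And>x t. 0 \<le> t \<Longrightarrow> t \<le> h \<Longrightarrow> norm (central_diff (2 * k) t (trig_sum N c) x) \<le> \<Omega>"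
    and h: "h > 0"
  shows "norm (trig_sum N (\<lambda>l. of_real (mean_symbol k (of_int l * h)) * c l) x)
           \<le> \<Omega> / real ((2 * k) choose k)"
proof -
  define W where "W t = trig_sum N (\<lambda>l. of_real (2 / h\<^sup>2 * (h - t) * diff_symbol k (of_int l * t)) * c l) x" for t
  have int: "(W has_integral trig_sum N (\<lambda>l. of_real (mean_symbol k (of_int l * h)) * c l) x) {0..h}"
    unfolding W_def trig_sum_def
    by (intro has_integral_sum has_integral_mult_left has_integral_of_real has_integral_diff_symbol h) auto
  have bound: "norm (W t) \<le> 2 / h\<^sup>2 * (h - t) * (\<Omega> / real ((2 * k) choose k))" if "t \<in> {0..h}" for t
  proof -
    have "W t = of_real (2 / h\<^sup>2 * (h - t)) * trig_sum N (\<lambda>l. of_real (diff_symbol k (of_int l * t)) * c l) x"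
      unfolding W_def trig_sum_scale[symmetric] by (simp add: mult.assoc)
    moreover have "norm (trig_sum N (\<lambda>l. of_real (diff_symbol k (of_int l * t)) * c l) x) \<le> \<Omega> / real ((2 * k) choose k)"
      using \<Omega>[of t x] that unfolding central_diff_trig_sum
      by (simp add: norm_mult norm_power field_simps)
    moreover have "2 / h\<^sup>2 * (h - t) \<ge> 0" using that by simp
    ultimately show ?thesis
      by (simp only: norm_mult norm_of_real abs_of_nonneg mult_left_mono)
  qed
  have int2: "((\<lambda>t. 2 / h\<^sup>2 * (h - t) * (\<Omega> / real ((2 * k) choose k))) has_integral 1 * (\<Omega> / real ((2 * k) choose k))) {0..h}"
    by (intro has_integral_mult_left has_integral_tent h)
  have "norm (integral {0..h} W) \<le> integral {0..h} (\<lambda>t. 2 / h\<^sup>2 * (h - t) * (\<Omega> / real ((2 * k) choose k)))"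
    by (rule integral_norm_bound_integral) (use int int2 bound in \<open>auto simp: has_integral_iff\<close>)
  then show ?thesis using int int2 by (simp add: has_integral_iff)
qed

section \<open>Convex replacement of 1 / l^2 and the second difference symbol\<close>

lemma inverse_square_tangent:
  fixes x y :: real
  assumes "x > 0" "y > 0"
  shows "1 / y\<^sup>2 - 2 * (x - y) / y ^ 3 \<le> 1 / x\<^sup>2"
proof -
  \<comment> \<open>The gap between 1 / x^2 and its tangent at y, in factored form.\<close>
  have "0 \<le> (y - x)\<^sup>2 * (y + 2 * x) / (x\<^sup>2 * y ^ 3)" using assms by simp
  also have "\<dots> = 1 / x\<^sup>2 - (1 / y\<^sup>2 - 2 * (x - y) / y ^ 3)"
    using assms by (simp add: field_simps power2_eq_square power3_eq_cube)
  finally show ?thesis by simp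
qed

text \<open>\<open>convex_multiplier_bound\<close> charges only the value at 0, and the tangent at p
  is the lowest continuation of 1 / x^2 to the left of p that stays convex on the reals.\<close>

definition capped_inverse_square :: "nat \<Rightarrow> nat \<Rightarrow> real" where
  "capped_inverse_square p i =
     (if i \<le> p then 1 / (real p)\<^sup>2 - 2 * (real i - real p) / real p ^ 3 else 1 / (real i)\<^sup>2)"

lemma capped_inverse_square_high: "p \<le> i \<Longrightarrow> capped_inverse_square p i = 1 / (real i)\<^sup>2"
  by (auto simp: capped_inverse_square_def)

lemma capped_inverse_square_nonneg: "0 \<le> capped_inverse_square p i"
proof (cases "i \<le> p")
  case True
  then have "2 * (real i - real p) / real p ^ 3 \<le> 0"
    by (intro divide_nonpos_nonneg) auto
  moreover have "0 \<le> 1 / (real p)\<^sup>2" by simp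
  moreover have "capped_inverse_square p i = 1 / (real p)\<^sup>2 - 2 * (real i - real p) / real p ^ 3"
    using True by (simp add: capped_inverse_square_def)
  ultimately show ?thesis by linarith
qed (simp add: capped_inverse_square_def)

lemma capped_inverse_square_tangent:
  assumes "p \<ge> 1" "i \<ge> 1"
  shows "1 / (real p)\<^sup>2 - 2 * (real i - real p) / real p ^ 3 \<le> capped_inverse_square p i"
  using assms inverse_square_tangent[of "real i" "real p"] by (auto simp: capped_inverse_square_def)

lemma capped_inverse_square_decreasing:
  assumes "p \<ge> 1"
  shows "capped_inverse_square p (Suc i) \<le> capped_inverse_square p i"
proof (cases "Suc i \<le> p")
  case True
  then show ?thesis using assms by (simp add: capped_inverse_square_def divide_right_mono)
next
  case False
  then show ?thesis using assms
    by (simp add: capped_inverse_square_high del: of_nat_Suc) (intro frac_le power_mono; simp)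
qed

text \<open>Up to p the first two values lie on the tangent and the third on or above it. Beyond p,
  the tangent inequalities at i + 1 for the neighbours i and i + 2 add up and their slopes
  cancel.\<close>

lemma capped_inverse_square_convex:
  assumes "p \<ge> 1"
  shows "2 * capped_inverse_square p (Suc i) \<le> capped_inverse_square p i + capped_inverse_square p (Suc (Suc i))"
proof (cases "Suc i \<le> p")
  case True
  then have *: "capped_inverse_square p i = 1 / (real p)\<^sup>2 - 2 * (real i - real p) / real p ^ 3"
    "capped_inverse_square p (Suc i) = 1 / (real p)\<^sup>2 - 2 * (real (Suc i) - real p) / real p ^ 3"
    by (auto simp: capped_inverse_square_def)
  define q where "q = 2 / real p ^ 3"
  have q: "2 * z / real p ^ 3 = q * z" for z by (simp add: q_def)
  show ?thesis
    using capped_inverse_square_tangent[OF assms, of "Suc (Suc i)"] unfolding * q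
    by (simp add: algebra_simps)
next
  case False
  then have "p \<le> i" "i \<ge> 1" using assms by auto
  then show ?thesis
    using inverse_square_tangent[of "real i" "real i + 1"] inverse_square_tangent[of "real i + 2" "real i + 1"]
    by (simp add: capped_inverse_square_high add.commute)
qed

lemma capped_inverse_square_0: "p \<ge> 1 \<Longrightarrow> capped_inverse_square p 0 = 3 / (real p)\<^sup>2"
  by (simp add: capped_inverse_square_def field_simps power2_eq_square power3_eq_cube)

text \<open>What is left of \<open>1 - mean_symbol k s\<close> once the factor 4 / s^2 is taken out;
  each 1 - cos is minus half a second difference of step (i + 1) h.\<close>

definition second_difference_symbol :: "nat \<Rightarrow> real \<Rightarrow> real" where
  "second_difference_symbol k s =
     (\<Sum>i<k. (-1) ^ i * (binomial_ratio k (Suc i) / (real (Suc i))\<^sup>2) * (1 - cos (real (Suc i) * s)))"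

lemma mean_symbol_eq:
  assumes "s \<noteq> 0"
  shows "1 - mean_symbol k s = 4 / s\<^sup>2 * second_difference_symbol k s"
proof -
  have "1 - mean_symbol k s = (\<Sum>i<k. 2 * ((-1) ^ i * binomial_ratio k (Suc i) * tent_symbol (real (Suc i) * s)))"
    by (simp add: mean_symbol_def sum_distrib_left)
  also have "\<dots> = (\<Sum>i<k. 4 / s\<^sup>2 * ((-1) ^ i * (binomial_ratio k (Suc i) / (real (Suc i))\<^sup>2) * (1 - cos (real (Suc i) * s))))"
  proof (rule sum.cong)
    fix i
    show "2 * ((-1) ^ i * binomial_ratio k (Suc i) * tent_symbol (real (Suc i) * s))
        = 4 / s\<^sup>2 * ((-1) ^ i * (binomial_ratio k (Suc i) / (real (Suc i))\<^sup>2) * (1 - cos (real (Suc i) * s)))"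
      using assms by (simp add: tent_symbol_def power_mult_distrib algebra_simps diff_divide_distrib del: of_nat_Suc)
  qed simp
  finally show ?thesis by (simp add: second_difference_symbol_def sum_distrib_left)
qed

text \<open>The two parts of 1 - cos are treated separately: the ones combine into a single signed
  multiple of the function, the cosines into means of translates.\<close>

lemma second_difference_symbol_bound:
  assumes B: "\<And>x. norm (trig_sum N c x) \<le> B"
  shows "norm (trig_sum N (\<lambda>l. of_real (second_difference_symbol k (of_int l * h)) * c l) x) \<le> 5 / 2 * B"
proof -
  define y where "y i = binomial_ratio k (Suc i) / (real (Suc i))\<^sup>2" for i
  define g where "g = trig_sum N c"
  have B0: "B \<ge> 0" using B[of 0] norm_ge_zero order_trans by blast
  have y0: "y i \<ge> 0" for i by (simp add: y_def binomial_ratio_nonneg)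
  have yd: "y (Suc i) \<le> y i" for i
    unfolding y_def by (intro frac_le binomial_ratio_nonneg binomial_ratio_decreasing power_mono) auto
  have y1: "y i \<le> 1 / (real (Suc i))\<^sup>2" for i
    unfolding y_def by (intro divide_right_mono binomial_ratio_le_1) simp
  have sym: "second_difference_symbol k (of_int l * h)
      = (\<Sum>i<k. (-1) ^ i * y i) - (\<Sum>i<k. ((-1) ^ i * y i) * cos (of_int l * (real (Suc i) * h)))" for l
    by (simp add: second_difference_symbol_def y_def right_diff_distrib sum_subtractf mult.left_commute del: of_nat_Suc)
  have "trig_sum N (\<lambda>l. of_real (second_difference_symbol k (of_int l * h)) * c l) x
     = trig_sum N (\<lambda>l. of_real (\<Sum>i<k. (-1) ^ i * y i) * c l -
         (\<Sum>i<k. of_real ((-1) ^ i * y i) * (of_real (cos (of_int l * (real (Suc i) * h))) * c l))) x"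
    by (rule trig_sum_cong)
      (simp add: sym left_diff_distrib sum_distrib_right mult.assoc del: of_nat_Suc)
  also have "\<dots> = of_real (\<Sum>i<k. (-1) ^ i * y i) * g x -
         (\<Sum>i<k. of_real ((-1) ^ i * y i) * ((g (x + real (Suc i) * h) + g (x - real (Suc i) * h)) / 2))"
    unfolding trig_sum_diff trig_sum_scale trig_sum_sum trig_sum_cos g_def ..
  also have "norm \<dots> \<le> (\<Sum>i<k. (-1) ^ i * y i) * B + (\<Sum>i<k. y i * B)"
  proof (rule order_trans[OF norm_triangle_ineq4], rule add_mono)
    show "norm (of_real (\<Sum>i<k. (-1) ^ i * y i) * g x) \<le> (\<Sum>i<k. (-1) ^ i * y i) * B"
      using alternating_sum_bounds[of y k] y0 yd B[of x] unfolding g_def norm_mult norm_of_real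
      by (simp add: mult_left_mono)
    show "norm (\<Sum>i<k. of_real ((-1) ^ i * y i) * ((g (x + real (Suc i) * h) + g (x - real (Suc i) * h)) / 2))
        \<le> (\<Sum>i<k. y i * B)"
    proof (rule sum_norm_le)
      fix i
      have "norm (g (x + real (Suc i) * h) + g (x - real (Suc i) * h)) \<le> B + B"
        unfolding g_def by (intro norm_triangle_mono B)
      then have "norm ((g (x + real (Suc i) * h) + g (x - real (Suc i) * h)) / 2) \<le> B"
        by (simp add: norm_divide)
      moreover have "norm (complex_of_real ((-1) ^ i * y i)) = y i"
        using y0[of i] by (simp add: norm_mult norm_power)
      ultimately show "norm (of_real ((-1) ^ i * y i) * ((g (x + real (Suc i) * h) + g (x - real (Suc i) * h)) / 2)) \<le> y i * B"
        using y0[of i] by (simp only: norm_mult mult_left_mono)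
    qed
  qed
  \<comment> \<open>The alternating sum being nonnegative, only the odd steps survive; bounding all steps
     separately would be too weak for a contraction.\<close>
  also have "\<dots> = (\<Sum>i<k. (1 + (-1) ^ i) * y i) * B"
    by (simp only: distrib_right sum.distrib sum_distrib_right mult_1_left add.commute)
  also have "\<dots> \<le> (\<Sum>i<k. (1 + (-1) ^ i) / (real (Suc i))\<^sup>2) * B"
  proof (intro mult_right_mono sum_mono B0)
    fix i
    show "(1 + (-1) ^ i) * y i \<le> (1 + (-1) ^ i) / (real (Suc i))\<^sup>2"
      using mult_left_mono[OF y1[of i], of "1 + (-1) ^ i"] by (simp add: minus_one_power_iff)
  qed
  also have "\<dots> \<le> 5 / 2 * B" by (intro mult_right_mono sum_odd_inverse_squares B0)
  finally show ?thesis .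
qed

section \<open>The Jackson-Stechkin inequality\<close>

text \<open>The approximant is the de la Vallee Poussin mean. The supremum S of its error satisfies
  S <= 41 D + (15/16) S with D = \<Omega> / (2k choose k), whence 656 = 16 * 41.\<close>

lemma trig_sum_approximation:
  assumes "n \<ge> 1"
    and \<Omega>: "\<And>x t. 0 \<le> t \<Longrightarrow> t < 2 * pi / real n \<Longrightarrow> norm (central_diff (2 * k) t (trig_sum N c) x) \<le> \<Omega>"
  obtains \<tau> where "\<tau> \<in> trig_polys n"
    "\<And>x. norm (trig_sum N c x - \<tau> x) \<le> 656 * (\<Omega> / real ((2 * k) choose k))"
proof -
  \<comment> \<open>The contraction factor is \<open>30 / (p h)\<^sup>2\<close>, and \<open>p h\<close> has to stay below \<open>2 \<pi> \<approx> \<surd>39.5\<close>.\<close>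
  define h where "h = 19 / 20 * (2 * pi / real n)"
  have h: "0 < h" "h < 2 * pi / real n" using \<open>n \<ge> 1\<close> by (auto simp: h_def field_simps)
  \<comment> \<open>Near enough to n to keep p h large, yet with n - p proportional to n, so that
    the de la Vallee Poussin norm stays below 40.\<close>
  define p where "p = nat \<lceil>19 / 20 * real n\<rceil>"
  have p: "19 / 20 * real n \<le> real p" "real p < 19 / 20 * real n + 1"
    unfolding p_def by linarith+
  have p1: "1 \<le> p"
  proof -
    have "real p > 0" using p(1) \<open>n \<ge> 1\<close> by linarith
    then show ?thesis by simp
  qed
  have pn: "p \<le> n" unfolding p_def by linarith
  \<comment> \<open>The factor 19/20 enters through both p and h: 361/200 = 2 (19/20)^2.\<close>
  have ph: "32 \<le> (real p * h)\<^sup>2"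
  proof -
    have "361 / 200 * pi = 19 / 20 * real n * h" using \<open>n \<ge> 1\<close> by (simp add: h_def)
    also have "\<dots> \<le> real p * h" using p(1) h(1) by (intro mult_right_mono) auto
    finally have "361 / 200 * pi \<le> real p * h" .
    moreover have "314 / 100 \<le> pi" using pi_approx(1) by simp
    ultimately have "361 / 200 * (314 / 100) \<le> real p * h" by linarith
    then have "(361 / 200 * (314 / 100))\<^sup>2 \<le> (real p * h)\<^sup>2" by (intro power_mono) auto
    then show ?thesis by (simp add: power2_eq_square)
  qed
  define D where "D = \<Omega> / real ((2 * k) choose k)"
  define v where "v l = complex_of_real (vallee_poussin n p l)" for l
  define gc where "gc l = c l - v l * c l" for l
  define \<mu> where "\<mu> l = complex_of_real (mean_symbol k (of_int l * h))" for l
  define \<sigma> where "\<sigma> l = complex_of_real (second_difference_symbol k (of_int l * h))" for l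
  define b where "b l = complex_of_real (capped_inverse_square p (nat \<bar>l\<bar>))" for l
  have mean: "norm (trig_sum N (\<lambda>l. \<mu> l * c l) x) \<le> D" for x
    unfolding \<mu>_def D_def by (rule mean_symbol_bound) (use \<Omega> h in auto)
  have D0: "D \<ge> 0" using mean[of 0] norm_ge_zero order_trans by blast
  have A: "norm (trig_sum N (\<lambda>l. \<mu> l * gc l) x) \<le> 41 * D" for x
  proof -
    \<comment> \<open>Multipliers commute, so the bound for the mean symbol passes to
      \<open>gc\<close> at the cost of the factor 1 + 40.\<close>
    have "trig_sum N (\<lambda>l. \<mu> l * gc l) x = trig_sum N (\<lambda>l. \<mu> l * c l) x - trig_sum N (\<lambda>l. v l * (\<mu> l * c l)) x"
      unfolding trig_sum_diff[symmetric] by (rule trig_sum_cong) (simp add: gc_def algebra_simps)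
    moreover have "norm (trig_sum N (\<lambda>l. v l * (\<mu> l * c l)) x) \<le> (real n + real p) / (real n + 2 - real p) * D"
      unfolding v_def by (rule vallee_poussin_bound) (use mean p1 pn in auto)
    moreover have "(real n + real p) / (real n + 2 - real p) * D \<le> 40 * D"
    proof (rule mult_right_mono[OF _ D0])
      have "0 < real n + 2 - real p" using pn by linarith
      moreover have "real n + real p \<le> 40 * (real n + 2 - real p)"
        using p(2) of_nat_0_le_iff[of n, where 'a = real] by argo
      ultimately show "(real n + real p) / (real n + 2 - real p) \<le> 40"
        by (simp add: pos_divide_le_eq)
    qed
    ultimately show ?thesis
      using norm_triangle_ineq4[of "trig_sum N (\<lambda>l. \<mu> l * c l) x" "trig_sum N (\<lambda>l. v l * (\<mu> l * c l)) x"] mean[of x]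
      by simp
  qed
  have split: "trig_sum N gc x = trig_sum N (\<lambda>l. \<mu> l * gc l) x
      + of_real (4 / h\<^sup>2) * trig_sum N (\<lambda>l. b l * (\<sigma> l * gc l)) x" for x
  proof -
    \<comment> \<open>Below p both sides vanish with \<open>gc\<close>; from p on, \<open>b\<close>
      is exactly 1 / l^2.\<close>
    have "gc l = \<mu> l * gc l + of_real (4 / h\<^sup>2) * (b l * (\<sigma> l * gc l))" for l
    proof (cases "\<bar>l\<bar> < int p")
      case True
      then show ?thesis using vallee_poussin_low[OF pn, of l] by (simp add: gc_def v_def)
    next
      case False
      then have l: "l \<noteq> 0" "p \<le> nat \<bar>l\<bar>" using p1 by auto
      have "1 - mean_symbol k (of_int l * h) = 4 / h\<^sup>2 * (capped_inverse_square p (nat \<bar>l\<bar>) * second_difference_symbol k (of_int l * h))"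
        using l h by (subst mean_symbol_eq) (auto simp: capped_inverse_square_high power_mult_distrib)
      then have "complex_of_real (1 - mean_symbol k (of_int l * h))
          = of_real (4 / h\<^sup>2 * (capped_inverse_square p (nat \<bar>l\<bar>) * second_difference_symbol k (of_int l * h)))"
        by (rule arg_cong)
      then have "1 - \<mu> l = of_real (4 / h\<^sup>2) * (b l * \<sigma> l)"
        unfolding \<mu>_def b_def \<sigma>_def of_real_mult[symmetric] by simp
      then have "(1 - \<mu> l) * gc l = of_real (4 / h\<^sup>2) * (b l * \<sigma> l) * gc l" by (rule arg_cong)
      then show ?thesis by (simp only: left_diff_distrib mult.assoc mult_1_left) (simp only: diff_eq_eq add.commute)
    qed
    then have "trig_sum N gc x = trig_sum N (\<lambda>l. \<mu> l * gc l + of_real (4 / h\<^sup>2) * (b l * (\<sigma> l * gc l))) x"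
      by (intro trig_sum_cong)
    then show ?thesis unfolding trig_sum_add trig_sum_scale .
  qed
  \<comment> \<open>The self-referential estimate can be absorbed because this supremum is
    finite.\<close>
  define S where "S = (SUP x. norm (trig_sum N gc x))"
  have "bdd_above (range (\<lambda>x. norm (trig_sum N gc x)))"
    using norm_trig_sum_le by (intro bdd_aboveI) blast
  then have S: "norm (trig_sum N gc x) \<le> S" for x
    unfolding S_def by (intro cSUP_upper) auto
  have S0: "S \<ge> 0" using S[of 0] norm_ge_zero order_trans by blast
  have "norm (trig_sum N gc x) \<le> 41 * D + 15 / 16 * S" for x
  proof -
    have step: "0 \<le> 4 / h\<^sup>2" by simp
    \<comment> \<open>The factors 4 / h^2, 3 / p^2 and 5/2 multiply to 30 / (p h)^2.\<close>
    have "norm (trig_sum N (\<lambda>l. b l * (\<sigma> l * gc l)) x) \<le> capped_inverse_square p 0 * (5 / 2 * S)"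
      unfolding b_def \<sigma>_def
      by (intro convex_multiplier_bound second_difference_symbol_bound S capped_inverse_square_nonneg
            capped_inverse_square_decreasing capped_inverse_square_convex p1)
    then have "norm (of_real (4 / h\<^sup>2) * trig_sum N (\<lambda>l. b l * (\<sigma> l * gc l)) x)
        \<le> 4 / h\<^sup>2 * (3 / (real p)\<^sup>2 * (5 / 2 * S))"
      unfolding norm_mult norm_of_real capped_inverse_square_0[OF p1] abs_of_nonneg[OF step]
      by (rule mult_left_mono[OF _ step])
    also have "\<dots> = 30 / (real p * h)\<^sup>2 * S" by (simp add: power_mult_distrib)
    also have "\<dots> \<le> 15 / 16 * S"
    proof (rule mult_right_mono[OF _ S0])
      have "30 / (real p * h)\<^sup>2 \<le> 30 / 32" using ph p1 h(1) by (intro divide_left_mono) auto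
      then show "30 / (real p * h)\<^sup>2 \<le> 15 / 16" by simp
    qed
    finally show ?thesis unfolding split[of x]
      using A[of x] by (intro norm_triangle_mono)
  qed
  then have "S \<le> 41 * D + 15 / 16 * S" unfolding S_def by (intro cSUP_least) auto
  then have SD: "S \<le> 656 * D" by simp
  show thesis
  proof (rule that)
    show "(\<lambda>x. trig_sum N (\<lambda>l. v l * c l) x) \<in> trig_polys n"
      unfolding trig_sum_def
    proof (rule trig_polys_sum)
      fix l
      show "(\<lambda>x. v l * c l * cis (of_int l * x)) \<in> trig_polys n"
      proof (cases "\<bar>l\<bar> \<le> int n")
        case False
        then have "v l = 0" using vallee_poussin_high[OF pn, of l] by (simp add: v_def)
        then show ?thesis by (simp add: trig_polys_zero)
      qed (intro trig_polys_scale trig_polys_cis)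
    qed
    fix x
    have "trig_sum N c x - trig_sum N (\<lambda>l. v l * c l) x = trig_sum N gc x"
      unfolding gc_def trig_sum_diff ..
    then show "norm (trig_sum N c x - trig_sum N (\<lambda>l. v l * c l) x) \<le> 656 * (\<Omega> / real ((2 * k) choose k))"
      using S[of x] SD unfolding D_def by simp
  qed
qed

section \<open>Passage to continuous functions and to all orders m\<close>

lemma norm_central_diff_le:
  assumes "\<And>x. norm (f x) \<le> F"
  shows "norm (central_diff m h f x) \<le> 2 ^ m * F"
proof -
  have "norm (central_diff m h f x) \<le> (\<Sum>i=0..m. real (m choose i) * F)"
    unfolding central_diff_def
    by (rule sum_norm_le) (use assms in \<open>auto simp: norm_mult norm_power intro!: mult_left_mono\<close>)
  also have "\<dots> = real (\<Sum>i\<le>m. m choose i) * F"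
    by (simp add: sum_distrib_right atMost_atLeast0)
  finally show ?thesis by (simp add: choose_row_sum)
qed

lemma central_diff_diff:
  "central_diff m h (\<lambda>x. f x - g x) x = central_diff m h f x - central_diff m h g x"
  by (simp add: central_diff_def right_diff_distrib sum_subtractf)

text \<open>Pascal's rule, with half steps aligning the nodes. It lets an odd order be replaced by
  the next even one.\<close>

lemma central_diff_Suc:
  "central_diff (Suc m) h f x = central_diff m h f (x + h / 2) - central_diff m h f (x - h / 2)"
proof -
  define G where "G i = f (x - real (Suc m) / 2 * h + real i * h)" for i
  have left_node: "x - h / 2 - real m / 2 * h + real i * h = x - real (Suc m) / 2 * h + real i * h" for i
    by (simp add: field_simps)
  have right_node: "x + h / 2 - real m / 2 * h + real i * h = x - real (Suc m) / 2 * h + real (Suc i) * h" for i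
    by (simp add: field_simps)
  define T where "T i = (-1) ^ (Suc m - i) * of_nat (m choose i) * G i" for i
  have "central_diff (Suc m) h f x = (\<Sum>i=0..Suc m. (-1) ^ (Suc m - i) * of_nat (Suc m choose i) * G i)"
    by (simp add: central_diff_def G_def)
  also have "\<dots> = T 0 + (\<Sum>i=0..m. (-1) ^ (m - i) * of_nat (m choose i) * G (Suc i) + T (Suc i))"
    unfolding sum.atLeast0_atMost_Suc_shift T_def
    by (simp add: algebra_simps)
  also have "\<dots> = (\<Sum>i=0..m. (-1) ^ (m - i) * of_nat (m choose i) * G (Suc i)) + (T 0 + (\<Sum>i=0..m. T (Suc i)))"
    by (simp add: sum.distrib algebra_simps)
  also have "T 0 + (\<Sum>i=0..m. T (Suc i)) = (\<Sum>i=0..Suc m. T i)"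
    unfolding sum.atLeast0_atMost_Suc_shift by simp
  \<comment> \<open>The last term contains \<open>m choose Suc m\<close>, which is 0.\<close>
  also have "\<dots> = (\<Sum>i=0..m. T i)"
    by (simp add: T_def)
  also have "\<dots> = - (\<Sum>i=0..m. (-1) ^ (m - i) * of_nat (m choose i) * G i)"
    unfolding sum_negf[symmetric] T_def by (intro sum.cong) (auto simp: Suc_diff_le)
  also have "(\<Sum>i=0..m. (-1) ^ (m - i) * of_nat (m choose i) * G i) = central_diff m h f (x - h / 2)"
    unfolding central_diff_def G_def left_node ..
  also have "(\<Sum>i=0..m. (-1) ^ (m - i) * of_nat (m choose i) * G (Suc i)) = central_diff m h f (x + h / 2)"
    unfolding central_diff_def G_def right_node ..
  finally show ?thesis by simp
qed

text \<open>Periodicity moves x into the base period. Boundedness of \<open>f\<close> bounds the set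
  of differences, as a real supremum requires.\<close>

lemma central_diff_le_modulus_smoothness:
  assumes f: "f \<in> circle_continuous" and h: "\<bar>h\<bar> < \<delta>"
  shows "norm (central_diff m h f x) \<le> modulus_smoothness m f \<delta>"
proof -
  obtain F where F: "\<And>x. norm (f x) \<le> F"
    using circle_continuous_bounded[OF f] by blast
  obtain k :: int where k: "x + 2 * pi * of_int k \<in> {-pi..<pi}"
    using ex_circle_representative by blast
  have "central_diff m h f x = central_diff m h f (x + 2 * pi * of_int k)"
    unfolding central_diff_def
  proof (intro sum.cong refl arg_cong2[of _ _ _ _ "(*)"])
    fix i
    show "f (x - real m / 2 * h + real i * h) = f (x + 2 * pi * of_int k - real m / 2 * h + real i * h)"
      using circle_continuous_periodic[OF f, of "x - real m / 2 * h + real i * h" k]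
      by (simp add: algebra_simps)
  qed
  moreover have "norm (central_diff m h f (x + 2 * pi * of_int k)) \<le> modulus_smoothness m f \<delta>"
  proof -
    have "bdd_above ((\<lambda>(x, h). norm (central_diff m h f x)) ` ({-pi..<pi} \<times> {h. \<bar>h\<bar> < \<delta>}))"
      using norm_central_diff_le[OF F] by (intro bdd_aboveI[of _ "2 ^ m * F"]) auto
    then show ?thesis
      using cSUP_upper[of "(x + 2 * pi * of_int k, h)" "{-pi..<pi} \<times> {h. \<bar>h\<bar> < \<delta>}"
          "\<lambda>(x, h). norm (central_diff m h f x)"] k h
      unfolding modulus_smoothness_def by auto
  qed
  ultimately show ?thesis by simp
qed

text \<open>The real infimum needs a lower bound: each \<open>circle_norm\<close> that occurs is
  nonnegative because the supremum defining it is over a bounded set.\<close>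

lemma best_approx_le:
  assumes f: "f \<in> circle_continuous" and \<tau>: "\<tau> \<in> trig_polys n"
    and e: "\<And>x. norm (f x - \<tau> x) \<le> e"
  shows "best_approx n f \<le> e"
proof -
  obtain F where F: "\<And>x. norm (f x) \<le> F"
    using circle_continuous_bounded[OF f] by blast
  have "0 \<le> circle_norm (\<lambda>x. f x - \<sigma> x)" if "\<sigma> \<in> trig_polys n" for \<sigma>
  proof -
    from that obtain c where c: "\<sigma> = trig_sum n c" by (auto simp: trig_polys_eq_range)
    have "norm (f x - \<sigma> x) \<le> F + (\<Sum>l=-int n..int n. norm (c l))" for x
      unfolding c by (intro order_trans[OF norm_triangle_ineq4] add_mono F norm_trig_sum_le)
    then have "bdd_above ((\<lambda>x. norm (f x - \<sigma> x)) ` {-pi..<pi})"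
      by (intro bdd_aboveI) auto
    then have "norm (f 0 - \<sigma> 0) \<le> circle_norm (\<lambda>x. f x - \<sigma> x)"
      unfolding circle_norm_def by (intro cSUP_upper) auto
    then show ?thesis using norm_ge_zero order_trans by blast
  qed
  then have "best_approx n f \<le> circle_norm (\<lambda>x. f x - \<tau> x)"
    unfolding best_approx_def using \<tau> by (intro cINF_lower bdd_belowI) auto
  also have "\<dots> \<le> e" unfolding circle_norm_def using e by (intro cSUP_least) auto
  finally show ?thesis .
qed

text \<open>Replacing \<open>f\<close> by a trigonometric sum within \<epsilon> changes the
  differences by at most 4^k \<epsilon>, which is arbitrarily small for fixed k.\<close>

lemma best_approx_le_central_diff_bound:
  assumes f: "f \<in> circle_continuous" and n: "n \<ge> 1"
    and \<Omega>: "\<And>x t. 0 \<le> t \<Longrightarrow> t < 2 * pi / real n \<Longrightarrow> norm (central_diff (2 * k) t f x) \<le> \<Omega>"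
  shows "best_approx n f \<le> 656 * (\<Omega> / real ((2 * k) choose k))"
proof (rule field_le_epsilon)
  fix e :: real assume "e > 0"
  define C where "C = real ((2 * k) choose k)"
  have C: "C \<ge> 1" unfolding C_def by (simp add: Suc_le_eq)
  \<comment> \<open>Makes the density error and the resulting change of the final bound add up to
    exactly \<open>e\<close>.\<close>
  define \<epsilon> where "\<epsilon> = e / (1 + 656 * (2 ^ (2 * k) / C))"
  have den: "1 + 656 * (2 ^ (2 * k) / C) > 0" using C by (intro add_pos_nonneg) auto
  have \<epsilon>: "\<epsilon> > 0" using \<open>e > 0\<close> den by (simp add: \<epsilon>_def)
  have \<epsilon>e: "\<epsilon> + 656 * (2 ^ (2 * k) / C) * \<epsilon> = e"
  proof -
    have "\<epsilon> * (1 + 656 * (2 ^ (2 * k) / C)) = e" using den by (simp add: \<epsilon>_def)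
    then show ?thesis by (simp add: algebra_simps)
  qed
  obtain N c where dense: "\<And>x. norm (f x - trig_sum N c x) \<le> \<epsilon>"
    using trig_poly_dense[OF f \<epsilon>] by blast
  have "norm (central_diff (2 * k) t (trig_sum N c) x) \<le> \<Omega> + 2 ^ (2 * k) * \<epsilon>"
    if "0 \<le> t" "t < 2 * pi / real n" for x t
    using norm_triangle_ineq4[of "central_diff (2 * k) t f x" "central_diff (2 * k) t (\<lambda>x. f x - trig_sum N c x) x"]
      \<Omega>[OF that, of x] norm_central_diff_le[of "\<lambda>x. f x - trig_sum N c x" \<epsilon> "2 * k" t x] dense
    by (simp add: central_diff_diff)
  then obtain \<tau> where \<tau>: "\<tau> \<in> trig_polys n"
    "\<And>x. norm (trig_sum N c x - \<tau> x) \<le> 656 * ((\<Omega> + 2 ^ (2 * k) * \<epsilon>) / C)"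
    using trig_sum_approximation[OF n, of k N c "\<Omega> + 2 ^ (2 * k) * \<epsilon>"] unfolding C_def by blast
  have "best_approx n f \<le> \<epsilon> + 656 * ((\<Omega> + 2 ^ (2 * k) * \<epsilon>) / C)"
  proof (rule best_approx_le[OF f \<tau>(1)])
    fix x
    show "norm (f x - \<tau> x) \<le> \<epsilon> + 656 * ((\<Omega> + 2 ^ (2 * k) * \<epsilon>) / C)"
      using norm_triangle_mono[OF dense[of x] \<tau>(2)[of x]] by simp
  qed
  also have "\<dots> = 656 * (\<Omega> / C) + e"
    unfolding \<epsilon>e[symmetric] by (simp add: add_divide_distrib algebra_simps)
  finally show "best_approx n f \<le> 656 * (\<Omega> / real ((2 * k) choose k)) + e" unfolding C_def .
qed

lemma inverse_central_binomial_le: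
  assumes "k > 0"
  shows "1 / real ((2 * k) choose k) \<le> 2 * real k / 2 ^ (2 * k)"
proof -
  have "1 / real ((2 * k) choose k) \<le> 1 / (4 ^ k / (2 * real k))"
    using central_binomial_lower_bound[OF assms] assms by (intro divide_left_mono) auto
  then show ?thesis by (simp add: power_mult)
qed

text \<open>For odd m the order m + 1 doubles \<Omega>, and 2^(m+1) in the denominator gives this
  factor back. What remains is m + 1 <= 2 m, hence 1312 = 2 * 656.\<close>

lemma best_approx_le_modulus_smoothness:
  assumes f: "f \<in> circle_continuous" and m: "1 \<le> m" "m \<le> n"
  shows "best_approx n f \<le> 1312 * (real m / 2 ^ m) * modulus_smoothness m f (2 * pi / real n)"
proof -
  define \<Omega> where "\<Omega> = modulus_smoothness m f (2 * pi / real n)"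
  have n: "n \<ge> 1" using m by simp
  have \<Omega>: "norm (central_diff m t f x) \<le> \<Omega>" if "0 \<le> t" "t < 2 * pi / real n" for t x
    unfolding \<Omega>_def by (rule central_diff_le_modulus_smoothness[OF f]) (use that in auto)
  have \<Omega>0: "\<Omega> \<ge> 0"
  proof -
    have "norm (central_diff m 0 f 0) \<le> \<Omega>" by (rule \<Omega>) (use n in auto)
    then show ?thesis using norm_ge_zero order_trans by blast
  qed
  show ?thesis
  proof (cases "even m")
    case True
    then obtain k where k: "m = 2 * k" by blast
    have "best_approx n f \<le> 656 * \<Omega> * (1 / real ((2 * k) choose k))"
      using best_approx_le_central_diff_bound[OF f n, of k \<Omega>] \<Omega> unfolding k by simp
    also have "\<dots> \<le> 656 * \<Omega> * (2 * real k / 2 ^ (2 * k))"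
      using m k \<Omega>0 by (intro mult_left_mono inverse_central_binomial_le) auto
    also have "\<dots> \<le> 1312 * (real m / 2 ^ m) * \<Omega>"
      using \<Omega>0 by (simp add: k field_simps)
    finally show ?thesis unfolding \<Omega>_def .
  next
    case False
    then obtain j where j: "m = 2 * j + 1" by (rule oddE)
    define k where "k = Suc j"
    have k: "2 * k = Suc m" using j by (simp add: k_def)
    have "norm (central_diff (2 * k) t f x) \<le> \<Omega> + \<Omega>" if "0 \<le> t" "t < 2 * pi / real n" for x t
      unfolding k central_diff_Suc
      by (intro order_trans[OF norm_triangle_ineq4] add_mono \<Omega> that)
    then have "best_approx n f \<le> 656 * (\<Omega> + \<Omega>) * (1 / real ((2 * k) choose k))"
      using best_approx_le_central_diff_bound[OF f n, of k "\<Omega> + \<Omega>"] by simp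
    also have "\<dots> \<le> 656 * (\<Omega> + \<Omega>) * (2 * real k / 2 ^ (2 * k))"
      using \<Omega>0 by (intro mult_left_mono inverse_central_binomial_le) (auto simp: k_def)
    also have "\<dots> = 656 * \<Omega> * (real (Suc m) / 2 ^ m)"
    proof -
      have "2 * real k = real (Suc m)" using k by linarith
      then show ?thesis unfolding k by simp
    qed
    also have "\<dots> \<le> 656 * \<Omega> * (2 * real m / 2 ^ m)"
      using \<Omega>0 m by (intro mult_left_mono divide_right_mono) auto
    also have "\<dots> = 1312 * (real m / 2 ^ m) * \<Omega>" by simp
    finally show ?thesis unfolding \<Omega>_def .
  qed
qed

theorem mainTheorem2:
  "\<exists>C::real. C > 0 \<and>
     (\<forall>m::nat. m \<ge> 1 \<longrightarrow>
        jackson_stechkin_const m \<le> ereal (C * 2 powr (- real m + (5 / 2) * log 2 (real m))))"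
proof (intro exI[of _ 1312] conjI allI impI)
  fix m :: nat assume m: "m \<ge> 1"
  have "jackson_stechkin_const m \<le> ereal (1312 * (real m / 2 ^ m))"
    unfolding jackson_stechkin_const_def
    by (rule INF_lower) (use best_approx_le_modulus_smoothness m in auto)
  also have "\<dots> \<le> ereal (1312 * 2 powr (- real m + (5 / 2) * log 2 (real m)))"
  proof -
    \<comment> \<open>The bound obtained has the first power of m; for m >= 1 the power 5/2
      dominates it.\<close>
    have "log 2 (real m) \<ge> 0" using m by simp
    then have "2 powr (- real m + log 2 (real m)) \<le> 2 powr (- real m + (5 / 2) * log 2 (real m))"
      by simp
    moreover have "2 powr (- real m + log 2 (real m)) = real m / 2 ^ m"
      unfolding powr_add using m by (simp add: powr_minus powr_realpow divide_inverse)
    ultimately have "real m / 2 ^ m \<le> 2 powr (- real m + (5 / 2) * log 2 (real m))"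
      by (simp only:)
    then show ?thesis unfolding ereal_less_eq by (intro mult_left_mono) auto
  qed
  finally show "jackson_stechkin_const m \<le> ereal (1312 * 2 powr (- real m + (5 / 2) * log 2 (real m)))" .
qed simp

end
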